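(* Let $G$ be a graph and let $\mathcal{H}=\{H_x \mid x\in V(G)\}$ be a family of graphs indexed by the vertices of $G$. Suppose that $H_x$ is shellable for every $x\in V(G)$ and that $G$ is a shellable graph having a shelling such that for all facets $F<F'$ of $G$ (in the order of this shelling) there exist a vertex $u\in F'\setminus F$ and a facet $F''<F'$ of $G$ such that $F'\setminus F''=\{u\}$ and $H_u$ is complete. Then the lexicographic product $G[\mathcal{H}]$ is shellable.
   Context: All graphs are non-empty (at least one vertex), finite and simple. The lexicographic product $G[\mathcal{H}]$ is the graph with vertex set $\bigcup_{x\in V(G)}\{(x,y)\mid y\in V(H_x)\}$ in which $(x,y)$ and $(x',y')$ are adjacent if either $x=x'$ and $y$ is adjacent to $y'$ in $H_x$, or $x$ is adjacent to $x'$ in $G$. The independence complex $\Delta_G$ of a graph $G$ is the simplicial complex on $V(G)$ whose faces are the independent sets of vertices of $G$. A facet of $G$ means a facet of $\Delta_G$, i.e. a maximal independent set of vertices of $G$. A simplicial complex (not necessarily pure) is shellable if its facets can be ordered $F_1,\dots,F_m$ so that for all $1\le i<j\le m$ there exist $v\in F_j\setminus F_i$ and $\ell\in\{1,\dots,j-1\}$ with $F_j\setminus F_\ell=\{v\}$; such an order is called a shelling. For a fixed shelling, $F<F'$ means that $F$ comes before $F'$ in the shelling. A graph is shellable if its independence complex is shellable, and a shelling of the graph is a shelling of its independence complex. *)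

theory Defs
  imports "Graph_Theory.Graph_Theory"
begin

(* pair_graph: finite, loop-free, symmetric relation on the vertex set. *)
definition nonempty_graph :: "'a pair_pre_digraph \<Rightarrow> bool" where
  "nonempty_graph G \<longleftrightarrow> pair_graph G \<and> pverts G \<noteq> {}"

definition complete_graph :: "'a pair_pre_digraph \<Rightarrow> bool" where
  "complete_graph G \<longleftrightarrow> complete_digraph (card (pverts G)) (with_proj G)"

definition lex_product ::
  "'a pair_pre_digraph \<Rightarrow> ('a \<Rightarrow> 'b pair_pre_digraph) \<Rightarrow> ('a \<times> 'b) pair_pre_digraph" where
  "lex_product G H =
     (let V = (SIGMA x:pverts G. pverts (H x)) in
      \<lparr> pverts = V,
        parcs = {((x, y), (x', y')) | x y x' y'.
                   (x, y) \<in> V \<and> (x', y') \<in> V \<and>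
                   (x = x' \<and> (y, y') \<in> parcs (H x) \<or> (x, x') \<in> parcs G)} \<rparr>)"

(* A simplicial complex is represented by its set of faces. *)
definition independence_complex :: "'a pair_pre_digraph \<Rightarrow> 'a set set" where
  "independence_complex G =
     {S. S \<subseteq> pverts G \<and> (\<forall>u\<in>S. \<forall>v\<in>S. (u, v) \<notin> parcs G)}"

definition facets :: "'a set set \<Rightarrow> 'a set set" where
  "facets \<Delta> = {F \<in> \<Delta>. \<forall>F'\<in>\<Delta>. F \<subseteq> F' \<longrightarrow> F' = F}"

(* Positions in the list are counted from 0. *)
definition shelling :: "'a set set \<Rightarrow> 'a set list \<Rightarrow> bool" where
  "shelling \<Delta> Fs \<longleftrightarrow>
     distinct Fs \<and> set Fs = facets \<Delta> \<and>
     (\<forall>i j. i < j \<and> j < length Fs \<longrightarrow>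
        (\<exists>v \<in> Fs ! j - Fs ! i. \<exists>l < j. Fs ! j - Fs ! l = {v}))"

definition shellable :: "'a set set \<Rightarrow> bool" where
  "shellable \<Delta> \<longleftrightarrow> (\<exists>Fs. shelling \<Delta> Fs)"

definition graph_shelling :: "'a pair_pre_digraph \<Rightarrow> 'a set list \<Rightarrow> bool" where
  "graph_shelling G Fs \<longleftrightarrow> shelling (independence_complex G) Fs"

definition shellable_graph :: "'a pair_pre_digraph \<Rightarrow> bool" where
  "shellable_graph G \<longleftrightarrow> shellable (independence_complex G)"

lemma nonempty_graph_lex_product:
  assumes G: "nonempty_graph G" and H: "\<And>x. x \<in> pverts G \<Longrightarrow> nonempty_graph (H x)"
  shows "nonempty_graph (lex_product G H)"
proof -
  let ?L = "lex_product G H"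
  interpret G: pair_graph G using G by (simp add: nonempty_graph_def)
  have Hg: "pair_graph (H x)" "pverts (H x) \<noteq> {}" if "x \<in> pverts G" for x
    using H[OF that] by (auto simp: nonempty_graph_def)
  have V: "pverts ?L = (SIGMA x:pverts G. pverts (H x))"
    by (simp add: lex_product_def Let_def)
  have A: "((x, y), (x', y')) \<in> parcs ?L \<longleftrightarrow>
      (x, y) \<in> pverts ?L \<and> (x', y') \<in> pverts ?L \<and>
      (x = x' \<and> (y, y') \<in> parcs (H x) \<or> (x, x') \<in> parcs G)" for x y x' y'
    by (auto simp: lex_product_def Let_def)
  have finV: "finite (pverts ?L)"
    unfolding V using G.pair_finite_verts Hg(1)
    by (intro finite_SigmaI) (simp_all add: pair_graph_def pair_digraph_def
        pair_fin_digraph.pair_finite_verts)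
  have sub: "parcs ?L \<subseteq> pverts ?L \<times> pverts ?L" using A by auto
  have symH: "(y', y) \<in> parcs (H x)" if "x \<in> pverts G" "(y, y') \<in> parcs (H x)" for x y y'
  proof -
    interpret Hx: pair_graph "H x" using Hg(1)[OF that(1)] .
    have "sym (parcs (H x))" using Hx.pair_sym_arcs by (simp add: symmetric_def)
    then show ?thesis using that(2) by (rule symD)
  qed
  have irrH: "(y, y) \<notin> parcs (H x)" if "x \<in> pverts G" for x y
  proof -
    interpret Hx: pair_graph "H x" using Hg(1)[OF that] .
    show ?thesis using Hx.pair_no_loops[of "(y, y)"] by simp blast
  qed
  have symG: "(x', x) \<in> parcs G" if "(x, x') \<in> parcs G" for x x'
  proof -
    have "sym (parcs G)" using G.pair_sym_arcs by (simp add: symmetric_def)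
    then show ?thesis using that by (rule symD)
  qed
  have irrG: "(x, x) \<notin> parcs G" for x
    using G.pair_no_loops[of "(x, x)"] by simp blast
  have "pair_graph ?L"
  proof unfold_locales
    show "finite (pverts ?L)" by (rule finV)
    show "finite (parcs ?L)" using finV sub by (meson finite_SigmaI finite_subset)
    show "symmetric (with_proj ?L)"
      unfolding symmetric_def with_proj_simps
    proof (rule symI)
      fix p q assume "(p, q) \<in> parcs ?L"
      moreover obtain x y x' y' where "p = (x, y)" "q = (x', y')" by (metis surj_pair)
      ultimately have "((x, y), (x', y')) \<in> parcs ?L" "p = (x, y)" "q = (x', y')" by simp_all
      then show "(q, p) \<in> parcs ?L"
        unfolding A V using symH symG by (metis A mem_Sigma_iff V)
    qed
    fix e assume e: "e \<in> parcs ?L"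
    show "fst e \<in> pverts ?L" "snd e \<in> pverts ?L" using e sub by auto
    obtain x y x' y' where xy: "e = ((x, y), (x', y'))" by (metis surj_pair)
    show "fst e \<noteq> snd e" using e irrH irrG unfolding xy A V by (metis fst_conv snd_conv mem_Sigma_iff prod.inject)
  qed
  moreover have "pverts ?L \<noteq> {}"
    using G Hg(2) unfolding V nonempty_graph_def by auto
  ultimately show ?thesis by (simp add: nonempty_graph_def)
qed

end

theory Submission
  imports Defs "HOL-Library.Product_Lexorder"
begin

text \<open>
  A facet of \<open>G[H]\<close> is a union \<open>SIGMA x:F. S x\<close> of facets \<open>S x\<close> of the \<open>H x\<close> placed over a facet
  \<open>F\<close> of \<open>G\<close> (\<open>facet_lex_product_iff\<close>), so it is determined by its shadow \<open>F\<close> and its fibres.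
  Order these sets by the position of \<open>F\<close> in the given shelling of \<open>G\<close> and, over the same \<open>F\<close>,
  by the sum of the positions of the \<open>S x\<close> in shellings of the \<open>H x\<close>, breaking ties arbitrarily.

  Let \<open>A\<close> be distinct from and not after \<open>B\<close>.  If both lie over the same \<open>F\<close>, comparing the two
  sums yields an \<open>x\<close> whose fibre in \<open>A\<close> precedes that in \<open>B\<close>; an exchange in the shelling of
  \<open>H x\<close> alters \<open>B\<close> in this one fibre, removes one vertex and lowers the sum.  If \<open>A\<close> lies over
  \<open>F\<close> and \<open>B\<close> over \<open>F' \<noteq> F\<close>, the hypothesis on \<open>G\<close> gives an earlier \<open>F''\<close> with
  \<open>F' - F'' = {u}\<close>, \<open>u \<notin> F\<close> and \<open>H u\<close> complete.  Keep the fibres of \<open>B\<close> over \<open>F' \<inter> F''\<close> and choose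
  any facets over \<open>F'' - F'\<close>: what \<open>B\<close> loses is exactly its fibre over \<open>u\<close>, and this fibre is a
  single vertex because \<open>H u\<close> is complete.

  Both cases work for every way of breaking the ties.  Shellings are therefore handled as rank
  functions that may have ties (\<open>exchange_rank\<close>): these combine by lexicographic pairs and sums,
  which would be awkward with explicit lists.  The argument above is \<open>exchange_rank_lex_product\<close>;
  \<open>exchange_rank_of_list\<close> and \<open>shellable_of_exchange_rank\<close> translate from and to lists.
\<close>

section \<open>Shellings as rank functions\<close>

text \<open>
  The predicate \<open>P\<close> restricts the exchanged vertices, so that the notion covers both an ordinary
  shelling (\<open>P\<close> always true) and the shelling of \<open>G\<close> in which \<open>P u\<close> says that \<open>H u\<close> is complete.
\<close>

definition exchange_rank :: "('v \<Rightarrow> bool) \<Rightarrow> 'v set set \<Rightarrow> ('v set \<Rightarrow> 'r::linorder) \<Rightarrow> bool" where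
  "exchange_rank P \<Delta> r \<longleftrightarrow>
     (\<forall>A\<in>facets \<Delta>. \<forall>B\<in>facets \<Delta>. A \<noteq> B \<and> r A \<le> r B \<longrightarrow>
        (\<exists>v\<in>B - A. P v \<and> (\<exists>C\<in>facets \<Delta>. r C < r B \<and> B - C = {v})))"

lemma exchange_rankE:
  assumes "exchange_rank P \<Delta> r" "A \<in> facets \<Delta>" "B \<in> facets \<Delta>" "A \<noteq> B" "r A \<le> r B"
  obtains v C where "v \<in> B" "v \<notin> A" "P v" "C \<in> facets \<Delta>" "r C < r B" "B - C = {v}"
  using assms unfolding exchange_rank_def by blast

lemma exchange_rank_of_list:
  assumes dist: "distinct Fs" and set: "set Fs = facets \<Delta>"
    and ex: "\<And>i j. i < j \<Longrightarrow> j < length Fs \<Longrightarrow>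
       \<exists>v \<in> Fs ! j - Fs ! i. \<exists>l < j. Fs ! j - Fs ! l = {v} \<and> P v"
  shows "\<exists>r :: 'v set \<Rightarrow> nat. exchange_rank P \<Delta> r"
proof -
  define r where "r = inv_into {..<length Fs} ((!) Fs)"
  have r: "r (Fs ! i) = i" if "i < length Fs" for i
    unfolding r_def using dist that by (intro inv_into_f_f) (auto simp: inj_on_def nth_eq_iff_index_eq)
  have "\<exists>v\<in>B - A. P v \<and> (\<exists>C\<in>facets \<Delta>. r C < r B \<and> B - C = {v})"
    if A: "A \<in> facets \<Delta>" and B: "B \<in> facets \<Delta>" and ne: "A \<noteq> B" and le: "r A \<le> r B" for A B
  proof -
    obtain i j where ij: "i < length Fs" "A = Fs ! i" "j < length Fs" "B = Fs ! j"
      using A B unfolding set[symmetric] in_set_conv_nth by blast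
    have "i < j" using ne le r ij by (metis order_le_less)
    from ex[OF this ij(3)] obtain v l
      where "v \<in> Fs ! j - Fs ! i" "l < j" "Fs ! j - Fs ! l = {v}" "P v" by blast
    moreover have "Fs ! l \<in> facets \<Delta>" "r (Fs ! l) = l"
      using \<open>l < j\<close> ij(3) r set by (auto simp flip: set)
    ultimately show ?thesis using ij r by metis
  qed
  then show ?thesis unfolding exchange_rank_def by blast
qed

text \<open>
  Sorting the facets by rank gives a shelling.  However ties are arranged, an earlier position
  means a rank that is not larger, and a strictly smaller rank means an earlier position.
\<close>

lemma shellable_of_exchange_rank:
  fixes r :: "'v set \<Rightarrow> 'r::linorder"
  assumes fin: "finite (facets \<Delta>)" and r: "exchange_rank P \<Delta> r"
  shows "shellable \<Delta>"
proof -
  obtain xs where xs: "set xs = facets \<Delta>" "distinct xs"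
    using finite_distinct_list[OF fin] by blast
  define Fs where "Fs = sort_key r xs"
  have Fs: "set Fs = facets \<Delta>" "distinct Fs" "sorted (map r Fs)"
    using xs by (simp_all add: Fs_def)
  have mono: "r (Fs ! i) \<le> r (Fs ! j)" if "i \<le> j" "j < length Fs" for i j
    using sorted_nth_mono[OF Fs(3), of i j] that by simp
  have "\<exists>v \<in> Fs ! j - Fs ! i. \<exists>l < j. Fs ! j - Fs ! l = {v}" if ij: "i < j" "j < length Fs" for i j
  proof -
    have "Fs ! i \<in> facets \<Delta>" "Fs ! j \<in> facets \<Delta>" using ij Fs(1) by (auto simp flip: Fs(1))
    moreover have "Fs ! i \<noteq> Fs ! j" using ij Fs(2) by (simp add: nth_eq_iff_index_eq)
    moreover have "r (Fs ! i) \<le> r (Fs ! j)" using ij mono by simp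
    ultimately obtain v C
      where v: "v \<in> Fs ! j" "v \<notin> Fs ! i" "C \<in> facets \<Delta>" "r C < r (Fs ! j)" "Fs ! j - C = {v}"
      using exchange_rankE[OF r] by metis
    obtain l where l: "l < length Fs" "C = Fs ! l"
      using v(3) unfolding Fs(1)[symmetric] in_set_conv_nth by blast
    have "l < j" using mono[of j l] v(4) l by (metis not_le)
    then show ?thesis using v l by blast
  qed
  then have "shelling \<Delta> Fs" unfolding shelling_def using Fs(1,2) by blast
  then show ?thesis unfolding shellable_def by blast
qed

section \<open>Facets of independence complexes\<close>

lemma facetsD:
  assumes "F \<in> facets \<Delta>"
  shows "F \<in> \<Delta>" and "F' \<in> \<Delta> \<Longrightarrow> F \<subseteq> F' \<Longrightarrow> F' = F"
  using assms unfolding facets_def by auto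

lemma facet_subset_pverts: "F \<in> facets (independence_complex G) \<Longrightarrow> F \<subseteq> pverts G"
  using facetsD(1) unfolding independence_complex_def by blast

lemma independence_complex_subset:
  "T \<in> independence_complex G \<Longrightarrow> S \<subseteq> T \<Longrightarrow> S \<in> independence_complex G"
  unfolding independence_complex_def by blast

lemma finite_pverts:
  assumes "nonempty_graph G"
  shows "finite (pverts G)"
proof -
  interpret pair_graph G using assms by (simp add: nonempty_graph_def)
  show ?thesis by (rule pair_finite_verts)
qed

lemma finite_independence_complex:
  assumes "nonempty_graph G"
  shows "finite (independence_complex G)"
proof (rule finite_subset)
  show "independence_complex G \<subseteq> Pow (pverts G)" unfolding independence_complex_def by blast
  show "finite (Pow (pverts G))" using finite_pverts[OF assms] by simp
qed

lemma finite_facets: "nonempty_graph G \<Longrightarrow> finite (facets (independence_complex G))"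
  using finite_independence_complex[of G] unfolding facets_def by simp

lemma independence_complex_singleton:
  assumes "nonempty_graph G" "y \<in> pverts G"
  shows "{y} \<in> independence_complex G"
proof -
  interpret pair_graph G using assms(1) by (simp add: nonempty_graph_def)
  have "(y, y) \<notin> parcs G" using pair_no_loops[of "(y, y)"] by simp blast
  then show ?thesis using assms(2) by (simp add: independence_complex_def)
qed

lemma facet_nonempty:
  assumes "nonempty_graph G" "S \<in> facets (independence_complex G)"
  shows "S \<noteq> {}"
proof
  assume S: "S = {}"
  obtain y where "y \<in> pverts G" using assms(1) by (auto simp: nonempty_graph_def)
  then show False
    using facetsD(2)[OF assms(2)] independence_complex_singleton[OF assms(1)] S by blast
qed

lemma facet_exists:
  assumes "nonempty_graph G"
  obtains S where "S \<in> facets (independence_complex G)"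
proof -
  have "{} \<in> independence_complex G" by (simp add: independence_complex_def)
  then obtain S where "S \<in> independence_complex G" "\<forall>T\<in>independence_complex G. S \<subseteq> T \<longrightarrow> S = T"
    using finite_has_maximal2[OF finite_independence_complex[OF assms]] by metis
  then have "S \<in> facets (independence_complex G)" unfolding facets_def by blast
  then show ?thesis by (rule that)
qed

lemma facet_complete_graph:
  assumes "nonempty_graph G" "complete_graph G" "S \<in> facets (independence_complex G)"
  obtains y where "S = {y}"
proof -
  obtain y where y: "y \<in> S" using facet_nonempty[OF assms(1,3)] by blast
  have "z = y" if "z \<in> S" for z
  proof -
    have "y \<in> pverts G" "z \<in> pverts G" "(y, z) \<notin> parcs G"
      using facetsD(1)[OF assms(3)] y that unfolding independence_complex_def by auto
    then show ?thesis
      using assms(2) unfolding complete_graph_def complete_digraph_pair_def by auto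
  qed
  then show ?thesis using that y by blast
qed

section \<open>Facets of the lexicographic product\<close>

lemma independence_complex_lex_product_iff:
  "T \<in> independence_complex (lex_product G H) \<longleftrightarrow>
     fst ` T \<in> independence_complex G \<and>
     (\<forall>x\<in>fst ` T. T `` {x} \<in> independence_complex (H x))"
  (is "?L \<longleftrightarrow> ?R")
proof
  assume L: ?L
  then have sub: "T \<subseteq> (SIGMA x:pverts G. pverts (H x))"
    by (simp add: independence_complex_def lex_product_def Let_def)
  have indep: "(x, x') \<notin> parcs G \<and> (x = x' \<longrightarrow> (y, y') \<notin> parcs (H x))"
    if xy: "(x, y) \<in> T" "(x', y') \<in> T" for x y x' y'
  proof -
    have "((x, y), (x', y')) \<notin> parcs (lex_product G H)"
      using L xy by (simp add: independence_complex_def)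
    moreover have "(x, y) \<in> (SIGMA x:pverts G. pverts (H x))"
      "(x', y') \<in> (SIGMA x:pverts G. pverts (H x))" using sub xy by blast+
    ultimately show ?thesis by (auto simp: lex_product_def Let_def)
  qed
  have "fst ` T \<in> independence_complex G"
    using sub indep by (auto simp: independence_complex_def)
  moreover have "T `` {x} \<in> independence_complex (H x)" for x
    using sub indep by (auto simp: independence_complex_def)
  ultimately show ?R by blast
next
  assume R: ?R
  have "(x, y) \<in> (SIGMA x:pverts G. pverts (H x))" if "(x, y) \<in> T" for x y
  proof -
    have "x \<in> fst ` T" using that by force
    then have "x \<in> pverts G" "T `` {x} \<subseteq> pverts (H x)"
      using R by (auto simp: independence_complex_def)
    then show ?thesis using that by blast
  qed
  then have "T \<subseteq> (SIGMA x:pverts G. pverts (H x))" by (simp add: subset_iff split_paired_All)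
  moreover have "(p, q) \<notin> parcs (lex_product G H)" if pq: "p \<in> T" "q \<in> T" for p q
  proof -
    obtain x y x' y' where xy: "p = (x, y)" "q = (x', y')" by (metis surj_pair)
    have "x \<in> fst ` T" "x' \<in> fst ` T" using pq xy by force+
    then have "(x, x') \<notin> parcs G"
      using R unfolding independence_complex_def by blast
    moreover have "T `` {x} \<in> independence_complex (H x)" using R \<open>x \<in> fst ` T\<close> by blast
    then have "x = x' \<Longrightarrow> (y, y') \<notin> parcs (H x)"
      using pq unfolding xy independence_complex_def by blast
    ultimately have "(x, x') \<notin> parcs G" "x = x' \<Longrightarrow> (y, y') \<notin> parcs (H x)" .
    then show ?thesis by (auto simp: lex_product_def Let_def xy)
  qed
  ultimately show ?L
    by (simp add: independence_complex_def lex_product_def Let_def)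
qed

text \<open>
  Maximality of \<open>T\<close> passes to the shadow because a new vertex \<open>x\<close> of \<open>G\<close> could be used to add any
  point over \<open>x\<close> to \<open>T\<close> (the \<open>H x\<close> have vertices), and to a fibre because a fibre can be enlarged
  while the shadow and the other fibres stay the same.
\<close>

lemma facet_lex_product_iff:
  assumes H: "\<forall>x\<in>pverts G. nonempty_graph (H x)"
  shows "T \<in> facets (independence_complex (lex_product G H)) \<longleftrightarrow>
     fst ` T \<in> facets (independence_complex G) \<and>
     (\<forall>x\<in>fst ` T. T `` {x} \<in> facets (independence_complex (H x)))"
  (is "?L \<longleftrightarrow> ?R")
proof
  assume L: ?L
  note T = facetsD(1)[OF L] and max = facetsD(2)[OF L]
  note T' = T[unfolded independence_complex_lex_product_iff]
  have "F = fst ` T" if F: "F \<in> independence_complex G" "fst ` T \<subseteq> F" for F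
  proof (rule ccontr)
    assume "F \<noteq> fst ` T"
    then obtain x where x: "x \<in> F" "x \<notin> fst ` T" using F(2) by blast
    then have "nonempty_graph (H x)" using F(1) H by (auto simp: independence_complex_def)
    moreover from this obtain y where "y \<in> pverts (H x)" by (auto simp: nonempty_graph_def)
    ultimately have y: "{y} \<in> independence_complex (H x)"
      by (rule independence_complex_singleton)
    have "insert x (fst ` T) \<in> independence_complex G"
      by (rule independence_complex_subset[OF F(1)]) (use F(2) x(1) in blast)
    moreover have "insert (x, y) T `` {z} \<in> independence_complex (H z)"
      if z: "z \<in> insert x (fst ` T)" for z
    proof (cases "z = x")
      case True
      then have "insert (x, y) T `` {z} = {y}" using x(2) by force
      then show ?thesis using y True by simp
    next
      case False
      then have "insert (x, y) T `` {z} = T `` {z}" by blast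
      then show ?thesis using T' z False by auto
    qed
    ultimately have "insert (x, y) T \<in> independence_complex (lex_product G H)"
      unfolding independence_complex_lex_product_iff by simp
    then have "(x, y) \<in> T" using max[of "insert (x, y) T"] by blast
    then show False using x(2) by force
  qed
  moreover have "S = T `` {x}"
    if x: "x \<in> fst ` T" and S: "S \<in> independence_complex (H x)" "T `` {x} \<subseteq> S" for x S
  proof -
    let ?T = "T \<union> {x} \<times> S"
    have "fst ` ?T = fst ` T" using x by force
    moreover have "?T `` {z} = (if z = x then S else T `` {z})" for z using S(2) by auto
    ultimately have "?T \<in> independence_complex (lex_product G H)"
      using T' S(1) unfolding independence_complex_lex_product_iff by simp
    then show ?thesis using max[of ?T] S(2) by blast
  qed
  ultimately show ?R using T' unfolding facets_def by blast
next
  assume R: ?R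
  have "T \<in> independence_complex (lex_product G H)"
    unfolding independence_complex_lex_product_iff using R by (simp add: facets_def)
  moreover have "T' = T"
    if T': "T' \<in> independence_complex (lex_product G H)" "T \<subseteq> T'" for T'
  proof -
    note I = T'(1)[unfolded independence_complex_lex_product_iff]
    have fst: "fst ` T' = fst ` T" using R I T'(2) facetsD(2)[of "fst ` T"] image_mono by meson
    have "T' `` {x} = T `` {x}" if "x \<in> fst ` T" for x
    proof (rule facetsD(2))
      show "T `` {x} \<in> facets (independence_complex (H x))" using R that by blast
      show "T' `` {x} \<in> independence_complex (H x)" using I that fst by blast
      show "T `` {x} \<subseteq> T' `` {x}" using T'(2) by blast
    qed
    then have "p \<in> T" if "p \<in> T'" for p
      using that fst by (metis Image_singleton_iff imageI prod.collapse)
    then show ?thesis using T'(2) by blast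
  qed
  ultimately show ?L unfolding facets_def by blast
qed

lemma facet_lex_product_Sigma:
  assumes H: "\<forall>x\<in>pverts G. nonempty_graph (H x)"
    and F: "F \<in> facets (independence_complex G)"
    and S: "\<And>x. x \<in> F \<Longrightarrow> S x \<in> facets (independence_complex (H x))"
  shows "Sigma F S \<in> facets (independence_complex (lex_product G H))"
    and "fst ` Sigma F S = F" and "x \<in> F \<Longrightarrow> Sigma F S `` {x} = S x"
proof -
  have "S x \<noteq> {}" if "x \<in> F" for x
    using facet_nonempty[OF _ S[OF that]] H that facet_subset_pverts[OF F] by blast
  then show fst: "fst ` Sigma F S = F" by force
  show fib: "Sigma F S `` {x} = S x" if "x \<in> F" for x using that by blast
  show "Sigma F S \<in> facets (independence_complex (lex_product G H))"
    using F S by (simp add: facet_lex_product_iff[OF H] fst fib)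
qed

section \<open>The rank function of the lexicographic product\<close>

text \<open>
  Both constructions of a smaller facet rely on the lexicographic order of the pairs.  An exchange
  inside one fibre keeps the first component and lowers one summand of the second.  An exchange in
  \<open>G\<close> lowers the first component, so the second may grow and the fibres over new vertices may be
  any facets.  An exchange in \<open>G\<close> discards a whole fibre at once; completeness of \<open>H u\<close> makes this
  the loss of a single vertex.
\<close>

lemma exchange_rank_lex_product:
  fixes rG :: "'a set \<Rightarrow> nat" and rH :: "'a \<Rightarrow> 'b set \<Rightarrow> nat"
  assumes G: "nonempty_graph G" and H: "\<forall>x\<in>pverts G. nonempty_graph (H x)"
    and rG: "exchange_rank (\<lambda>u. complete_graph (H u)) (independence_complex G) rG"
    and rH: "\<And>x. x \<in> pverts G \<Longrightarrow> exchange_rank (\<lambda>_. True) (independence_complex (H x)) (rH x)"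
  shows "exchange_rank (\<lambda>_. True) (independence_complex (lex_product G H))
           (\<lambda>T. (rG (fst ` T), \<Sum>x\<in>fst ` T. rH x (T `` {x})))"
    (is "exchange_rank _ ?\<Delta> ?r")
proof -
  note facet_iff = facet_lex_product_iff[OF H]
  note Sigma_facet = facet_lex_product_Sigma[OF H]
  have eq_Sigma: "T = (SIGMA x:fst ` T. T `` {x})" for T :: "('a \<times> 'b) set" by force
  have "\<exists>v\<in>B - A. \<exists>C\<in>facets ?\<Delta>. ?r C < ?r B \<and> B - C = {v}"
    if A: "A \<in> facets ?\<Delta>" and B: "B \<in> facets ?\<Delta>" and ne: "A \<noteq> B" and le: "?r A \<le> ?r B" for A B
  proof -
    note A' = A[unfolded facet_iff] and B' = B[unfolded facet_iff]
    have sub: "fst ` B \<subseteq> pverts G"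
      using B' facet_subset_pverts by blast
    show ?thesis
    proof (cases "fst ` A = fst ` B")
      case same: True
      have fin: "finite (fst ` B)" using sub finite_pverts[OF G] by (rule finite_subset)
      \<comment> \<open>Otherwise every fibre of \<open>B\<close> that differs from that of \<open>A\<close> would have smaller rank, and the
        sum for \<open>B\<close> would be strictly smaller than the sum for \<open>A\<close>.\<close>
      have "\<exists>x\<in>fst ` B. A `` {x} \<noteq> B `` {x} \<and> rH x (A `` {x}) \<le> rH x (B `` {x})"
      proof (rule ccontr)
        assume *: "\<not> ?thesis"
        obtain z where z: "z \<in> fst ` B" "A `` {z} \<noteq> B `` {z}"
          using ne same eq_Sigma[of A] eq_Sigma[of B] by (metis (no_types, lifting) Sigma_cong)
        have "(\<Sum>x\<in>fst ` B. rH x (B `` {x})) < (\<Sum>x\<in>fst ` B. rH x (A `` {x}))"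
        proof (rule sum_strict_mono_ex1[OF fin])
          show "\<forall>x\<in>fst ` B. rH x (B `` {x}) \<le> rH x (A `` {x})"
            using * by (metis le_cases)
          show "\<exists>x\<in>fst ` B. rH x (B `` {x}) < rH x (A `` {x})"
            using * z by (meson not_le)
        qed
        then show False using le same by simp
      qed
      then obtain x where x: "x \<in> fst ` B" "A `` {x} \<noteq> B `` {x}"
        "rH x (A `` {x}) \<le> rH x (B `` {x})" by blast
      have "x \<in> pverts G" using x(1) sub by blast
      with x A' B' same obtain v S where v: "v \<in> B `` {x}" "v \<notin> A `` {x}"
        "S \<in> facets (independence_complex (H x))" "rH x S < rH x (B `` {x})" "B `` {x} - S = {v}"
        using exchange_rankE[OF rH] by metis
      define D where "D = (\<lambda>z. if z = x then S else B `` {z})"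
      define C where "C = Sigma (fst ` B) D"
      have "D z \<in> facets (independence_complex (H z))" if "z \<in> fst ` B" for z
        using bspec[OF conjunct2[OF B'] that] v(3) by (simp add: D_def)
      note C = Sigma_facet[OF conjunct1[OF B'] this, folded C_def]
      have "(\<Sum>z\<in>fst ` B. rH z (C `` {z})) < (\<Sum>z\<in>fst ` B. rH z (B `` {z}))"
        by (rule sum_strict_mono_ex1[OF fin]) (use C(3) x(1) v(4) in \<open>auto simp: D_def\<close>)
      then have "?r C < ?r B" using C(2) by simp
      moreover have "B - C = {(x, v)}"
        using v(1,5) by (force simp: C_def D_def split: if_splits)
      ultimately show ?thesis using C(1) v(1,2) by blast
    next
      case False
      have "rG (fst ` A) \<le> rG (fst ` B)" using le by auto
      then obtain u F where u: "u \<in> fst ` B" "u \<notin> fst ` A" "complete_graph (H u)"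
        "F \<in> facets (independence_complex G)" "rG F < rG (fst ` B)" "fst ` B - F = {u}"
        using A' B' False exchange_rankE[OF rG] by metis
      have "u \<in> pverts G" using u(1) sub by blast
      then obtain y where y: "B `` {u} = {y}"
        using facet_complete_graph[OF _ u(3)] H B' u(1) by metis
      define D where "D = (\<lambda>z. if z \<in> fst ` B then B `` {z}
                                else SOME S. S \<in> facets (independence_complex (H z)))"
      define C where "C = Sigma F D"
      have "D z \<in> facets (independence_complex (H z))" if "z \<in> F" for z
      proof -
        have "z \<in> pverts G" using that facet_subset_pverts[OF u(4)] by blast
        then have "\<exists>S. S \<in> facets (independence_complex (H z))" using facet_exists H by metis
        then have "(SOME S. S \<in> facets (independence_complex (H z)))
            \<in> facets (independence_complex (H z))"
          by (rule someI_ex)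
        then show ?thesis using bspec[OF conjunct2[OF B'], of z] by (simp add: D_def)
      qed
      note C = Sigma_facet[OF u(4) this, folded C_def]
      have "?r C < ?r B" using C(2) u(5) by simp
      moreover have "B - C = {(u, y)}"
      proof -
        have "p \<in> B - C \<longleftrightarrow> p \<in> B \<and> fst p \<in> fst ` B - F" for p
          by (cases p) (force simp: C_def D_def)
        then have "p \<in> B - C \<longleftrightarrow> p \<in> B \<and> fst p = u" for p using u(6) by simp
        then show ?thesis using y by force
      qed
      moreover have "(u, y) \<in> B - A" using y u(2) by force
      ultimately show ?thesis using C(1) by blast
    qed
  qed
  then show ?thesis unfolding exchange_rank_def by blast
qed

theorem theorem2p15:
  fixes G :: "'a pair_pre_digraph" and H :: "'a \<Rightarrow> 'b pair_pre_digraph"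
  assumes "nonempty_graph G"
    and "\<And>x. x \<in> pverts G \<Longrightarrow> nonempty_graph (H x)"
    and "\<And>x. x \<in> pverts G \<Longrightarrow> shellable_graph (H x)"
    and "\<exists>Fs. graph_shelling G Fs \<and>
           (\<forall>i j. i < j \<and> j < length Fs \<longrightarrow>
              (\<exists>u \<in> Fs ! j - Fs ! i. \<exists>l < j.
                 Fs ! j - Fs ! l = {u} \<and> complete_graph (H u)))"
  shows "shellable_graph (lex_product G H)"
proof -
  obtain rG :: "'a set \<Rightarrow> nat"
    where rG: "exchange_rank (\<lambda>u. complete_graph (H u)) (independence_complex G) rG"
  proof -
    obtain Fs where Fs: "graph_shelling G Fs"
      "\<And>i j. i < j \<Longrightarrow> j < length Fs \<Longrightarrow> \<exists>u \<in> Fs ! j - Fs ! i. \<exists>l < j.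
         Fs ! j - Fs ! l = {u} \<and> complete_graph (H u)"
      using assms(4) by blast
    have "distinct Fs" "set Fs = facets (independence_complex G)"
      using Fs(1) by (simp_all add: graph_shelling_def shelling_def)
    from exchange_rank_of_list[OF this Fs(2)] show ?thesis using that by blast
  qed
  have "\<exists>r :: 'b set \<Rightarrow> nat. exchange_rank (\<lambda>_. True) (independence_complex (H x)) r"
    if "x \<in> pverts G" for x
  proof -
    obtain Fs where "shelling (independence_complex (H x)) Fs"
      using assms(3)[OF \<open>x \<in> pverts G\<close>] by (auto simp: shellable_graph_def shellable_def)
    then show ?thesis by (intro exchange_rank_of_list[of Fs]) (auto simp: shelling_def)
  qed
  then obtain rH :: "'a \<Rightarrow> 'b set \<Rightarrow> nat"
    where "\<And>x. x \<in> pverts G \<Longrightarrow> exchange_rank (\<lambda>_. True) (independence_complex (H x)) (rH x)"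
    by metis
  then have "exchange_rank (\<lambda>_. True) (independence_complex (lex_product G H))
      (\<lambda>T. (rG (fst ` T), \<Sum>x\<in>fst ` T. rH x (T `` {x})))"
    by (intro exchange_rank_lex_product assms(1) rG) (use assms(2) in blast)+
  moreover have "finite (facets (independence_complex (lex_product G H)))"
    by (intro finite_facets nonempty_graph_lex_product assms(1,2))
  ultimately show ?thesis
    unfolding shellable_graph_def using shellable_of_exchange_rank by blast
qed

end
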